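(* Let $\mathcal D\subset\mathbb R^d$ be a finite data set and $N\ge1$. The activation fan $\Sigma_{\mathcal D}(N)$ is a complete polyhedral fan, i.e. it is a collection of polyhedral cones in $\Theta(d,N)$ such that the intersection of any two cones is a face of both and such that the union of the cones is all of $\Theta(d,N)$.
   Context: $\Theta(d,N)\cong\mathbb R^{N(d+1)}$ is the space of parameters $\theta=(a_1,\mathbf s_1,\dots,a_N,\mathbf s_N)$, $a_i\in\mathbb R$, $\mathbf s_i\in\mathbb R^d$, and $f_\theta(\mathbf x)=\max_{i\in[N]}(a_i+\langle\mathbf s_i,\mathbf x\rangle)$. A data point $\mathbf p\in\mathcal D$ activates the $i$-th term of $f_\theta$ if $f_\theta(\mathbf p)=a_i+\langle\mathbf s_i,\mathbf p\rangle$. The activation pattern of $(f_\theta,\mathcal D)$ is the bipartite graph on nodes $\mathcal D\sqcup[N]$ with edges $\{\mathbf p i\mid\mathbf p\text{ activates the }i\text{-th term of }f_\theta\}$. For a bipartite graph $G$ on $\mathcal D\sqcup[N]$ the activation cone $C_{\mathcal D}(G)\subseteq\Theta(d,N)$ is the Euclidean closure of $\{\theta\mid G\text{ is the activation pattern of }(f_\theta,\mathcal D)\}$. The activation fan $\Sigma_{\mathcal D}(N)$ is the set of all (nonempty) activation cones in $\Theta(d,N)$. *)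

theory Defs
  imports "HOL-Analysis.Analysis"
begin

text \<open>
  The number \<open>N \<ge> 1\<close> of terms is \<open>CARD('n)\<close> and the dimension \<open>d\<close> is \<open>CARD('d)\<close>.
  A parameter \<open>\<theta>\<close> has components \<open>\<theta> $ i = (a\<^sub>i, s\<^sub>i)\<close>; with the product norms of the
  library this type is the Euclidean space of dimension \<open>N (d + 1)\<close>.
\<close>

type_synonym ('d, 'n) params = "(real \<times> (real ^ 'd)) ^ 'n"

definition term_value :: "('d::finite, 'n::finite) params \<Rightarrow> 'n \<Rightarrow> real ^ 'd \<Rightarrow> real" where
  "term_value \<theta> i x = fst (\<theta> $ i) + snd (\<theta> $ i) \<bullet> x"

definition max_affine :: "('d::finite, 'n::finite) params \<Rightarrow> real ^ 'd \<Rightarrow> real" where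
  "max_affine \<theta> x = (MAX i. term_value \<theta> i x)"

definition activates :: "('d::finite, 'n::finite) params \<Rightarrow> real ^ 'd \<Rightarrow> 'n \<Rightarrow> bool" where
  "activates \<theta> p i \<longleftrightarrow> max_affine \<theta> p = term_value \<theta> i p"

text \<open>
  A bipartite graph on the nodes \<open>D \<squnion> [N]\<close> is given by its edge set, a subset of \<open>D \<times> UNIV\<close>.
\<close>

definition activation_pattern ::
    "(real ^ 'd) set \<Rightarrow> ('d::finite, 'n::finite) params \<Rightarrow> ((real ^ 'd) \<times> 'n) set" where
  "activation_pattern D \<theta> = {(p, i). p \<in> D \<and> activates \<theta> p i}"

definition activation_cone ::
    "(real ^ 'd) set \<Rightarrow> ((real ^ 'd) \<times> 'n) set \<Rightarrow> ('d::finite, 'n::finite) params set" where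
  "activation_cone D G = closure {\<theta>. activation_pattern D \<theta> = G}"

definition activation_fan :: "(real ^ 'd) set \<Rightarrow> ('d::finite, 'n::finite) params set set" where
  "activation_fan D =
     {activation_cone D G | G. G \<subseteq> D \<times> UNIV \<and> activation_cone D G \<noteq> {}}"

text \<open>The library predicates \<^const>\<open>cone\<close> and \<^const>\<open>polyhedron\<close> also hold for the empty set.\<close>

definition polyhedral_cone :: "'a::euclidean_space set \<Rightarrow> bool" where
  "polyhedral_cone C \<longleftrightarrow> C \<noteq> {} \<and> cone C \<and> polyhedron C"

definition complete_polyhedral_fan :: "'a::euclidean_space set set \<Rightarrow> bool" where
  "complete_polyhedral_fan \<Sigma> \<longleftrightarrow>
     (\<forall>C\<in>\<Sigma>. polyhedral_cone C) \<and>
     (\<forall>C\<in>\<Sigma>. \<forall>C'\<in>\<Sigma>. (C \<inter> C') face_of C \<and> (C \<inter> C') face_of C') \<and>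
     \<Union>\<Sigma> = UNIV"

end

theory Submission
  imports Defs
begin

text \<open>
  Fix a finite \<open>D\<close> and call a graph \<open>G\<close> realised if it is the activation pattern of some
  parameter. The value of a fixed term at a fixed point is linear in \<open>\<theta>\<close>, so the set \<open>cone_above D G\<close>
  of parameters whose activation pattern contains \<open>G\<close> is cut out by finitely many linear
  inequalities. The proof rests on one observation (\<open>activation_pattern_combination\<close>): if at
  every data point two parameters share an active term, then every positive combination of them has
  exactly the common edges as its pattern. It applies to any two elements of \<open>cone_above D G\<close> if
  \<open>G\<close> is realised, because a maximum over the terms is attained, so that \<open>G\<close> has an edge at every
  data point. This has two consequences.

  First, the cone of a realised \<open>G\<close> is \<open>cone_above D G\<close>: if \<open>\<theta>\<^sub>0\<close> realises \<open>G\<close> and the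
  pattern of \<open>\<theta>\<close> contains \<open>G\<close>, then \<open>\<theta> + \<epsilon> \<theta>\<^sub>0\<close> has pattern \<open>G\<close> for all \<open>\<epsilon> > 0\<close> and tends
  to \<open>\<theta>\<close>. Hence the cones of the fan are polyhedral, and they cover the parameter space because
  every \<open>\<theta>\<close> lies in the cone of its own pattern.

  Second, for realised \<open>G\<close> the set \<open>cone_above D G \<inter> cone_above D G'\<close> is a face of
  \<open>cone_above D G\<close>: a point in the open segment between two elements of \<open>cone_above D G\<close> is a
  positive combination of parameters that share the edges of \<open>G\<close>, so if its pattern contains \<open>G'\<close>, so do the patterns of both ends.
\<close>

text \<open>
  The vector \<open>axis i (1, p)\<close> represents evaluation of the \<open>i\<close>-th term at \<open>p\<close> as a linear
  functional on the parameter space.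
\<close>

lemma term_value_eq_inner: "term_value \<theta> i p = axis i (1, p) \<bullet> \<theta>"
  by (simp add: term_value_def inner_axis' inner_prod_def inner_commute[of _ p])

lemma term_value_combination:
  "term_value (a *\<^sub>R \<theta> + b *\<^sub>R \<eta>) i p = a * term_value \<theta> i p + b * term_value \<eta> i p"
  by (simp add: term_value_eq_inner inner_add_right)

lemma activates_iff: "activates \<theta> p i \<longleftrightarrow> (\<forall>j. term_value \<theta> j p \<le> term_value \<theta> i p)"
proof -
  have "activates \<theta> p i \<longleftrightarrow> (MAX i. term_value \<theta> i p) = term_value \<theta> i p"
    by (simp add: activates_def max_affine_def)
  also have "\<dots> \<longleftrightarrow> (\<forall>j. term_value \<theta> j p \<le> term_value \<theta> i p)"
    by (subst Max_eq_iff) auto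
  finally show ?thesis .
qed

lemma activates_exists: "\<exists>i. activates \<theta> p i"
proof -
  have "max_affine \<theta> p \<in> range (\<lambda>i. term_value \<theta> i p)"
    unfolding max_affine_def by (rule Max_in) auto
  then show ?thesis
    by (auto simp: activates_def)
qed

text \<open>
  If the term \<open>j\<close> attains both maxima, then the combination of the maxima is attained by \<open>j\<close>, so
  another term attains it only if neither of its two summands falls short of its maximum.
\<close>

lemma activates_combination:
  assumes "a > 0" "b > 0" and j: "activates \<theta> p j" "activates \<eta> p j"
  shows "activates (a *\<^sub>R \<theta> + b *\<^sub>R \<eta>) p i \<longleftrightarrow> activates \<theta> p i \<and> activates \<eta> p i"
proof
  assume "activates \<theta> p i \<and> activates \<eta> p i"
  then show "activates (a *\<^sub>R \<theta> + b *\<^sub>R \<eta>) p i"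
    using assms(1,2) by (auto simp: activates_iff term_value_combination intro!: add_mono)
next
  assume "activates (a *\<^sub>R \<theta> + b *\<^sub>R \<eta>) p i"
  then have sum_le: "a * term_value \<theta> j p + b * term_value \<eta> j p
      \<le> a * term_value \<theta> i p + b * term_value \<eta> i p"
    by (simp add: activates_iff term_value_combination)
  have le: "term_value \<theta> i p \<le> term_value \<theta> j p" "term_value \<eta> i p \<le> term_value \<eta> j p"
    using j by (auto simp: activates_iff)
  then have "a * term_value \<theta> i p \<le> a * term_value \<theta> j p"
      "b * term_value \<eta> i p \<le> b * term_value \<eta> j p"
    using assms(1,2) by simp_all
  with sum_le have "a * term_value \<theta> i p = a * term_value \<theta> j p"
      "b * term_value \<eta> i p = b * term_value \<eta> j p"
    by linarith+
  then have "term_value \<theta> i p = term_value \<theta> j p" "term_value \<eta> i p = term_value \<eta> j p"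
    using assms(1,2) by simp_all
  with j show "activates \<theta> p i \<and> activates \<eta> p i"
    by (simp add: activates_def)
qed

lemma activation_pattern_combination:
  assumes "a > 0" "b > 0"
    and "\<And>p. p \<in> D \<Longrightarrow> \<exists>j. (p, j) \<in> activation_pattern D \<theta> \<inter> activation_pattern D \<eta>"
  shows "activation_pattern D (a *\<^sub>R \<theta> + b *\<^sub>R \<eta>) =
    activation_pattern D \<theta> \<inter> activation_pattern D \<eta>"
proof -
  have "activates (a *\<^sub>R \<theta> + b *\<^sub>R \<eta>) p i \<longleftrightarrow> activates \<theta> p i \<and> activates \<eta> p i"
    if "p \<in> D" for p i
  proof -
    obtain j where "activates \<theta> p j" "activates \<eta> p j"
      using assms(3)[OF \<open>p \<in> D\<close>] by (auto simp: activation_pattern_def)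
    then show ?thesis
      by (rule activates_combination[OF assms(1,2)])
  qed
  then show ?thesis
    by (auto simp: activation_pattern_def)
qed

lemma activation_pattern_covers: "p \<in> D \<Longrightarrow> \<exists>j. (p, j) \<in> activation_pattern D \<theta>"
  using activates_exists by (auto simp: activation_pattern_def)

definition cone_above ::
    "(real ^ 'd) set \<Rightarrow> ((real ^ 'd) \<times> 'n) set \<Rightarrow> ('d::finite, 'n::finite) params set" where
  "cone_above D G = {\<theta>. G \<subseteq> activation_pattern D \<theta>}"

lemma cone_above_eq_halfspaces:
  assumes "G \<subseteq> D \<times> UNIV"
  shows "cone_above D G = (\<Inter>(p, i)\<in>G. \<Inter>j. {\<theta>. (axis j (1, p) - axis i (1, p)) \<bullet> \<theta> \<le> 0})"
proof -
  have "G \<subseteq> activation_pattern D \<theta> \<longleftrightarrow> (\<forall>(p, i)\<in>G. \<forall>j. term_value \<theta> j p \<le> term_value \<theta> i p)"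
    for \<theta> :: "('a, 'b) params"
    using assms by (auto simp: activation_pattern_def activates_iff)
  then show ?thesis
    by (simp add: cone_above_def term_value_eq_inner inner_diff_left set_eq_iff case_prod_unfold)
qed

lemma polyhedral_cone_cone_above:
  assumes "finite D" "G \<subseteq> D \<times> UNIV"
  shows "polyhedral_cone (cone_above D G)"
proof -
  have "finite G"
    using assms finite_subset by fastforce
  then have "polyhedron (cone_above D G)"
    unfolding cone_above_eq_halfspaces[OF assms(2)]
    by (auto intro!: polyhedron_Inter simp: polyhedron_halfspace_le)
  moreover have "0 \<in> cone_above D G"
    using assms(2) by (simp add: cone_above_eq_halfspaces case_prod_unfold)
  moreover have "cone (cone_above D G)"
    unfolding cone_above_eq_halfspaces[OF assms(2)]
    by (simp add: cone_def case_prod_unfold mult_le_0_iff)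
  ultimately show ?thesis
    by (auto simp: polyhedral_cone_def)
qed

text \<open>
  A limit of parameters with pattern \<open>G\<close> can gain active terms but not lose any; conversely, moving
  towards \<open>\<theta>\<^sub>0\<close> removes every edge outside \<open>G\<close> at once.
\<close>

lemma activation_cone_eq_cone_above:
  assumes "finite D" and real: "activation_pattern D \<theta>\<^sub>0 = G"
  shows "activation_cone D G = cone_above D G"
proof
  have "G \<subseteq> D \<times> UNIV"
    using real by (auto simp: activation_pattern_def)
  then have "closed (cone_above D G)"
    using polyhedral_cone_cone_above[OF assms(1)] polyhedron_imp_closed
    by (auto simp: polyhedral_cone_def)
  then show "activation_cone D G \<subseteq> cone_above D G"
    unfolding activation_cone_def by (intro closure_minimal) (auto simp: cone_above_def)
next
  show "cone_above D G \<subseteq> activation_cone D G"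
  proof
    fix \<theta> assume "\<theta> \<in> cone_above D G"
    then have sub: "G \<subseteq> activation_pattern D \<theta>"
      by (simp add: cone_above_def)
    have common: "activation_pattern D \<theta> \<inter> activation_pattern D \<theta>\<^sub>0 = G"
      using sub real by blast
    have "\<exists>j. (p, j) \<in> activation_pattern D \<theta> \<inter> activation_pattern D \<theta>\<^sub>0" if "p \<in> D" for p
      unfolding common using activation_pattern_covers[OF that, of \<theta>\<^sub>0] real by simp
    then have "activation_pattern D (1 *\<^sub>R \<theta> + \<epsilon> *\<^sub>R \<theta>\<^sub>0) = G" if "\<epsilon> > 0" for \<epsilon>
      using that unfolding common[symmetric] by (intro activation_pattern_combination) simp_all
    then have perturbed: "activation_pattern D (\<theta> + \<epsilon> *\<^sub>R \<theta>\<^sub>0) = G" if "\<epsilon> > 0" for \<epsilon>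
      using that by simp
    have "(\<lambda>n. \<theta> + inverse (real (Suc n)) *\<^sub>R \<theta>\<^sub>0) \<longlonglongrightarrow> \<theta> + 0 *\<^sub>R \<theta>\<^sub>0"
      by (intro tendsto_intros LIMSEQ_inverse_real_of_nat)
    then show "\<theta> \<in> activation_cone D G"
      unfolding activation_cone_def closure_sequential
      using perturbed by (intro exI[of _ "\<lambda>n. \<theta> + inverse (real (Suc n)) *\<^sub>R \<theta>\<^sub>0"]) simp
  qed
qed

text \<open>
  The two ends of a segment are compared at each data point through a term that is active at both;
  the edges of the realised graph \<open>G\<close> supply it.
\<close>

lemma cone_above_Int_face:
  assumes "finite D" and real: "activation_pattern D \<theta>\<^sub>0 = G" and "G' \<subseteq> D \<times> UNIV"
  shows "(cone_above D G \<inter> cone_above D G') face_of cone_above D G"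
  unfolding face_of_def
proof (intro conjI ballI impI)
  have "G \<subseteq> D \<times> UNIV"
    using real by (auto simp: activation_pattern_def)
  then show "convex (cone_above D G \<inter> cone_above D G')"
    using polyhedral_cone_cone_above[OF assms(1)] assms(3)
    by (intro convex_Int polyhedron_imp_convex) (auto simp: polyhedral_cone_def)
next
  fix \<theta> \<eta> \<zeta>
  assume ends: "\<theta> \<in> cone_above D G" "\<eta> \<in> cone_above D G"
    and \<zeta>: "\<zeta> \<in> cone_above D G \<inter> cone_above D G'" "\<zeta> \<in> open_segment \<theta> \<eta>"
  obtain u where u: "0 < u" "u < 1" "\<zeta> = (1 - u) *\<^sub>R \<theta> + u *\<^sub>R \<eta>"
    using \<zeta>(2) by (auto simp: in_segment)
  have "\<exists>j. (p, j) \<in> activation_pattern D \<theta> \<inter> activation_pattern D \<eta>" if "p \<in> D" for p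
    using activation_pattern_covers[OF that, of \<theta>\<^sub>0] real ends by (auto simp: cone_above_def)
  then have "activation_pattern D \<zeta> = activation_pattern D \<theta> \<inter> activation_pattern D \<eta>"
    unfolding u(3) using u(1,2) by (intro activation_pattern_combination) auto
  then show "\<theta> \<in> cone_above D G \<inter> cone_above D G'" "\<eta> \<in> cone_above D G \<inter> cone_above D G'"
    using ends \<zeta>(1) by (auto simp: cone_above_def)
qed auto

text \<open>
  A graph that is not realised has an empty activation cone, so the nonempty cones are those of the
  realised graphs.
\<close>

lemma activation_fan_eq:
  fixes D :: "(real ^ 'd::finite) set"
  assumes "finite D"
  shows "(activation_fan D :: ('d, 'n::finite) params set set) =
    range (\<lambda>\<theta>. cone_above D (activation_pattern D \<theta>))"
proof (intro equalityI subsetI)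
  fix C :: "('d, 'n) params set"
  assume "C \<in> activation_fan D"
  then obtain G where C: "C = activation_cone D G" "activation_cone D G \<noteq> {}"
    by (auto simp: activation_fan_def)
  then obtain \<theta> :: "('d, 'n) params" where "activation_pattern D \<theta> = G"
    by (auto simp: activation_cone_def)
  then show "C \<in> range (\<lambda>\<theta>. cone_above D (activation_pattern D \<theta>))"
    using C(1) activation_cone_eq_cone_above[OF assms] by blast
next
  fix C :: "('d, 'n) params set"
  assume "C \<in> range (\<lambda>\<theta>. cone_above D (activation_pattern D \<theta>))"
  then obtain \<theta> where C: "C = cone_above D (activation_pattern D \<theta>)"
    by auto
  then have "C = activation_cone D (activation_pattern D \<theta>)"
    using activation_cone_eq_cone_above[OF assms refl] by metis
  moreover have "\<theta> \<in> C"
    by (simp add: C cone_above_def)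
  moreover have "activation_pattern D \<theta> \<subseteq> D \<times> UNIV"
    by (auto simp: activation_pattern_def)
  ultimately show "C \<in> activation_fan D"
    unfolding activation_fan_def mem_Collect_eq by (metis empty_iff)
qed

theorem proposition5p5:
  fixes D :: "(real ^ 'd::finite) set"
  assumes "finite D"
  shows "complete_polyhedral_fan (activation_fan D :: ('d, 'n::finite) params set set)"
proof -
  let ?C = "\<lambda>\<theta> :: ('d, 'n) params. cone_above D (activation_pattern D \<theta>)"
  have sub: "activation_pattern D \<theta> \<subseteq> D \<times> UNIV" for \<theta> :: "('d, 'n) params"
    by (auto simp: activation_pattern_def)
  have "polyhedral_cone (?C \<theta>)" for \<theta>
    by (rule polyhedral_cone_cone_above[OF assms sub])
  moreover have face: "(?C \<theta> \<inter> ?C \<eta>) face_of ?C \<theta>" for \<theta> \<eta>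
    by (rule cone_above_Int_face[OF assms refl sub])
  moreover have "(?C \<theta> \<inter> ?C \<eta>) face_of ?C \<eta>" for \<theta> \<eta>
    using face[of \<eta> \<theta>] by (simp add: Int_commute)
  moreover have "\<theta> \<in> ?C \<theta>" for \<theta>
    by (simp add: cone_above_def)
  then have "(\<Union>\<theta>. ?C \<theta>) = UNIV"
    by blast
  ultimately show ?thesis
    by (simp add: complete_polyhedral_fan_def activation_fan_eq[OF assms])
qed

end
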